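(* Let $D(t)\in\mathbb{Q}[t]$ be a nonconstant polynomial whose Pell equation has a fundamental solution $(u,v)$ with $u,v\in\mathbb{Q}[t]$. For a positive integer $N$ define $$I(N):=\{P(t)\in\mathbb{Q}[t]\ \text{monic irreducible} : \deg P\leq N,\ P(t)\mid v^{\mathrm{new}}_n(t)\text{ for some integer } n\geq 1\}.$$ Then $\# I(N)\leq 4N^2\deg u$ for every positive integer $N$.
   Context: For $D$ nonconstant, Pell's equation for $D$ is $x^2-Dy^2=1$ with $x,y\in\mathbb{C}[t]$. A fundamental solution is a solution $(u,v)$ with $v\neq 0$ of minimal degree among all solutions with $y\neq0$. For integers $n\geq 1$ define $u_n,v_n$ by $u_n+v_n\sqrt{D}=(u+v\sqrt{D})^n$. The "new part" $v^{\mathrm{new}}_n$ of $v_n$ is the polynomial determined by $v_n=\prod_{m\mid n}v^{\mathrm{new}}_m$ for all $n\geq 1$; equivalently $v^{\mathrm{new}}_n=\prod_{m\mid n}v_m^{\mu(n/m)}$, where $\mu$ is the Möbius function. *)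

theory Defs
  imports Complex_Main "HOL-Computational_Algebra.Computational_Algebra"
begin

definition pell_solution :: "'a::comm_ring_1 poly \<Rightarrow> 'a poly \<Rightarrow> 'a poly \<Rightarrow> bool" where
  "pell_solution D x y \<longleftrightarrow> x ^ 2 - D * y ^ 2 = 1"

text \<open>The degree of a solution \<open>(x, y)\<close> is taken to be that of \<open>x\<close>. For nonconstant \<open>D\<close> over a
  field and \<open>y \<noteq> 0\<close> we have \<open>2 * degree x = degree D + 2 * degree y\<close>, so minimising
  \<open>degree y\<close> instead gives the same solutions.\<close>

definition pell_fundamental :: "'a::comm_ring_1 poly \<Rightarrow> 'a poly \<Rightarrow> 'a poly \<Rightarrow> bool" where
  "pell_fundamental D u v \<longleftrightarrow> pell_solution D u v \<and> v \<noteq> 0 \<and>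
     (\<forall>x y. pell_solution D x y \<and> y \<noteq> 0 \<longrightarrow> degree u \<le> degree x)"

text \<open>A pair \<open>(a, b)\<close> stands for \<open>a + b * sqrt D\<close>.\<close>

definition sqrt_mult :: "'a::comm_ring_1 poly \<Rightarrow> 'a poly \<times> 'a poly \<Rightarrow> 'a poly \<times> 'a poly \<Rightarrow> 'a poly \<times> 'a poly" where
  "sqrt_mult D p q = (fst p * fst q + D * snd p * snd q, fst p * snd q + snd p * fst q)"

primrec sqrt_power :: "'a::comm_ring_1 poly \<Rightarrow> 'a poly \<times> 'a poly \<Rightarrow> nat \<Rightarrow> 'a poly \<times> 'a poly" where
  "sqrt_power D p 0 = (1, 0)"
| "sqrt_power D p (Suc n) = sqrt_mult D p (sqrt_power D p n)"

definition pell_u :: "'a::comm_ring_1 poly \<Rightarrow> 'a poly \<Rightarrow> 'a poly \<Rightarrow> nat \<Rightarrow> 'a poly" where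
  "pell_u D u v n = fst (sqrt_power D (u, v) n)"

definition pell_v :: "'a::comm_ring_1 poly \<Rightarrow> 'a poly \<Rightarrow> 'a poly \<Rightarrow> nat \<Rightarrow> 'a poly" where
  "pell_v D u v n = snd (sqrt_power D (u, v) n)"

lemma poly_pell_u_v:
  assumes "s ^ 2 = poly D t"
  shows "poly (pell_u D u v n) t + poly (pell_v D u v n) t * s = (poly u t + poly v t * s) ^ n"
proof (induction n)
  case 0
  show ?case by (simp add: pell_u_def pell_v_def)
next
  case (Suc n)
  have "poly (pell_u D u v (Suc n)) t + poly (pell_v D u v (Suc n)) t * s =
    (poly u t + poly v t * s) * (poly (pell_u D u v n) t + poly (pell_v D u v n) t * s)"
    by (simp add: pell_u_def pell_v_def sqrt_mult_def assms[symmetric] algebra_simps power2_eq_square)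
  with Suc show ?case by simp
qed

text \<open>Only the values at positive indices are meaningful: the value of \<open>w\<close> at \<open>0\<close> is unconstrained.
  At positive indices \<open>w\<close> is unique as soon as all \<open>pell_v D u v k\<close> with \<open>k \<ge> 1\<close> are nonzero.\<close>

definition pell_v_new :: "'a::comm_ring_1 poly \<Rightarrow> 'a poly \<Rightarrow> 'a poly \<Rightarrow> nat \<Rightarrow> 'a poly" where
  "pell_v_new D u v n =
     (THE p. \<exists>w. (\<forall>k\<ge>1. pell_v D u v k = (\<Prod>m | m dvd k. w m)) \<and> p = w n)"

definition pell_new_factors :: "rat poly \<Rightarrow> rat poly \<Rightarrow> rat poly \<Rightarrow> nat \<Rightarrow> rat poly set" where
  "pell_new_factors D u v N =
     {P. lead_coeff P = 1 \<and> irreducible P \<and> degree P \<le> N \<and> (\<exists>n\<ge>1. P dvd pell_v_new D u v n)}"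

end

theory Submission
  imports
    Defs
    "HOL-Computational_Algebra.Field_as_Ring"
    "HOL-Library.Real_Mod"
    "HOL-Number_Theory.Totient"
    "Subresultants.More_Homomorphisms"
begin

text \<open>
  For \<open>n \<ge> 2\<close> the new part of \<open>v\<^sub>n\<close> is \<open>\<psi>\<^sub>n(u)\<close>, where \<open>\<psi>\<^sub>n\<close> is a rational polynomial of degree
  \<open>\<phi>(n)\<close> whose roots are the numbers \<open>cos (\<pi> k / n)\<close> with \<open>k\<close> coprime to \<open>n\<close>. If \<open>P\<close> divides it and
  \<open>\<alpha>\<close> is a complex root of \<open>P\<close>, then \<open>\<rat>(\<alpha>)\<close> contains such a number \<open>u(\<alpha>)\<close>, and as all primitive
  roots of unity of the same order are conjugate, \<open>2 * degree P \<ge> \<phi>(2 n)\<close>. Comparing with the degree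
  \<open>\<phi>(n) * degree u\<close> of \<open>\<psi>\<^sub>n(u)\<close> leaves at most \<open>degree u\<close> factors for even and \<open>2 * degree u\<close> for
  odd \<open>n\<close>. Moreover \<open>\<phi>(2 n) \<le> 2 N\<close> forces \<open>n \<le> 2 N\<^sup>2\<close> or \<open>n = 3\<close>, so there are at most \<open>N\<^sup>2\<close> relevant
  \<open>n\<close> of each parity. Together with the factors of \<open>v\<^sub>1 = v\<close> this gives
  \<open>(1 + 3 N\<^sup>2) * degree u \<le> 4 N\<^sup>2 * degree u\<close>.
\<close>

hide_const (open) module.smult

interpretation of_rat_poly_hom: map_poly_inj_idom_hom "of_rat :: rat \<Rightarrow> 'a::field_char_0" ..

section \<open>Conjugates of roots of unity\<close>

lemma prime_dvd_binomial_power: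
  fixes x y :: "'a::comm_ring_1"
  assumes "prime p"
  shows "of_nat p dvd (x + y) ^ p - x ^ p - y ^ p"
proof -
  have "p > 0" using assms prime_gt_0_nat by blast
  have "(x + y) ^ p = (\<Sum>k\<le>p. of_nat (p choose k) * x ^ k * y ^ (p - k))"
    by (rule binomial_ring)
  also have "\<dots> = (\<Sum>k\<in>{0,p}. of_nat (p choose k) * x ^ k * y ^ (p - k)) +
      (\<Sum>k\<in>{..p} - {0,p}. of_nat (p choose k) * x ^ k * y ^ (p - k))"
    by (subst sum.subset_diff[of "{0,p}"]) (auto simp: add_ac)
  also have "(\<Sum>k\<in>{0,p}. of_nat (p choose k) * x ^ k * y ^ (p - k)) = x ^ p + y ^ p"
    using \<open>p > 0\<close> by (simp add: add_ac)
  finally have "(x + y) ^ p - x ^ p - y ^ p =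
      (\<Sum>k\<in>{..p} - {0,p}. of_nat (p choose k) * x ^ k * y ^ (p - k))"
    by simp
  also have "of_nat p dvd \<dots>"
  proof (intro dvd_sum)
    fix k assume k: "k \<in> {..p} - {0,p}"
    then have "p dvd (p choose k)"
      using assms by (intro dvd_choose_prime) auto
    then have "of_nat p dvd (of_nat (p choose k) :: 'a)"
      by (metis dvd_def of_nat_mult)
    then show "of_nat p dvd of_nat (p choose k) * x ^ k * y ^ (p - k)"
      by (simp add: dvd_mult2)
  qed
  finally show ?thesis .
qed

lemma prime_dvd_power_diff_int:
  fixes a :: int
  assumes "prime p"
  shows "int p dvd a ^ p - a"
proof (induction a rule: int_induct[of _ 0])
  case base
  then show ?case using prime_gt_0_nat[OF assms] by (simp add: power_0_left)
next
  case (step1 a)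
  have "int p dvd (a + 1) ^ p - a ^ p - 1 ^ p"
    using prime_dvd_binomial_power[OF assms, of a 1] by simp
  from dvd_add[OF this step1.IH] show ?case by (simp add: algebra_simps)
next
  case (step2 a)
  have "int p dvd (a - 1 + 1) ^ p - (a - 1) ^ p - 1 ^ p"
    using prime_dvd_binomial_power[OF assms, of "a - 1" 1] by simp
  from dvd_diff[OF step2.IH this] show ?case by (simp add: algebra_simps)
qed

text \<open>Raising to the \<open>p\<close>-th power is additive modulo \<open>p\<close> and fixes
  integers by Fermat, so it only replaces \<open>X\<close> by \<open>X^p\<close>. The induction runs
  along the Horner form \<open>a + X * f\<close>.\<close>

lemma prime_dvd_pcompose_diff_power:
  fixes f :: "int poly"
  assumes "prime p"
  shows "of_nat p dvd pcompose f (monom 1 p) - f ^ p"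
proof (induction f)
  case 0
  then show ?case using assms prime_gt_0_nat[of p] by (simp add: power_0_left)
next
  case (pCons a f)
  let ?X = "[:0, 1:] :: int poly"
  have eq: "pCons a f = [:a:] + ?X * f" by simp
  have 1: "of_nat p dvd ([:a:] + ?X * f) ^ p - [:a:] ^ p - (?X * f) ^ p"
    by (rule prime_dvd_binomial_power[OF assms])
  have "int p dvd a ^ p - a" by (rule prime_dvd_power_diff_int[OF assms])
  then have 2: "of_nat p dvd [:a:] ^ p - [:a:]"
    by (simp add: of_nat_poly poly_const_pow const_poly_dvd)
  have 3: "of_nat p dvd monom 1 p * (pcompose f (monom 1 p) - f ^ p)"
    using pCons.IH by (rule dvd_mult)
  have X: "?X ^ p = monom 1 p" by (metis x_as_monom x_pow_n)
  have eq': "monom 1 p * (pcompose f (monom 1 p) - f ^ p) - ([:a:] ^ p - [:a:])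
     - (([:a:] + ?X * f) ^ p - [:a:] ^ p - (?X * f) ^ p)
     = pcompose (pCons a f) (monom 1 p) - (pCons a f) ^ p"
    unfolding eq[symmetric] pcompose_pCons power_mult_distrib X right_diff_distrib by simp
  show ?case using dvd_diff[OF dvd_diff[OF 3 2] 1] unfolding eq' .
qed

lemma diff_dvd_pcompose_diff:
  fixes f a b :: "'a::comm_ring_1 poly"
  shows "a - b dvd pcompose f a - pcompose f b"
proof (induction f)
  case (pCons c f)
  have "pcompose (pCons c f) a - pcompose (pCons c f) b =
      a * (pcompose f a - pcompose f b) + (a - b) * pcompose f b"
    by (simp add: pcompose_pCons algebra_simps)
  with pCons show ?case by (simp add: dvd_add dvd_mult)
qed simp

text \<open>Pseudo-division multiplies the dividend by a power of the leading coefficient of the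
  divisor, which is 1 here. This gives division with remainder over the integers.\<close>

lemma monic_remainder_exists:
  fixes f g :: "'a::{comm_ring_1,semiring_1_no_zero_divisors} poly"
  assumes "lead_coeff f = 1"
  shows "\<exists>r. f dvd g - r \<and> (r = 0 \<or> degree r < degree f)"
proof -
  have "f \<noteq> 0" using assms by auto
  obtain q r where qr: "pseudo_divmod g f = (q, r)" by force
  from pseudo_divmod[OF \<open>f \<noteq> 0\<close> qr] assms show ?thesis
    by (intro exI[of _ r]) (auto simp: dvd_def)
qed

lemma remainder_unique:
  fixes f r s :: "'a::idom poly"
  assumes "f dvd g - r" "r = 0 \<or> degree r < degree f"
    and "f dvd g - s" "s = 0 \<or> degree s < degree f"
  shows "r = s"
proof (rule ccontr)
  assume "r \<noteq> s"
  have "f dvd (g - s) - (g - r)" using assms(3,1) by (rule dvd_diff)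
  then have "f dvd r - s" by simp
  then have "degree f \<le> degree (r - s)" using \<open>r \<noteq> s\<close> by (intro dvd_imp_degree_le) auto
  moreover have "degree (r - s) < degree f"
    using assms(2,4) \<open>r \<noteq> s\<close> by (auto intro: degree_diff_less)
  ultimately show False by simp
qed

text \<open>The remainder of \<open>f(x\<^sup>k)\<close> modulo \<open>f\<close> depends only on \<open>k\<close> modulo \<open>d\<close>, so its coefficients are
  bounded independently of \<open>k\<close>; for a prime \<open>k\<close> they are divisible by \<open>k\<close>.\<close>
lemma monic_divisor_dvd_pcompose_monom:
  fixes f :: "int poly"
  assumes "lead_coeff f = 1" "f dvd monom 1 d - 1" "d > 0"
  shows "\<exists>A. \<forall>p. prime p \<and> p > A \<longrightarrow> f dvd pcompose f (monom 1 p)"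
proof -
  have "\<exists>r. f dvd pcompose f (monom 1 k) - r \<and> (r = 0 \<or> degree r < degree f)" for k
    by (rule monic_remainder_exists[OF assms(1)])
  then obtain R where R: "\<And>k. f dvd pcompose f (monom 1 k) - R k"
      "\<And>k. R k = 0 \<or> degree (R k) < degree f"
    by metis
  have per: "R k = R (k mod d)" for k
  proof (rule remainder_unique[OF R(1,2)])
    \<comment> \<open>Modulo \<open>f\<close> the power \<open>X^d\<close> is 1, so
      \<open>X^k\<close> and \<open>X^(k mod d)\<close> are congruent, and substituting congruent
      polynomials into \<open>f\<close> gives congruent results.\<close>
    have "k = k mod d + d * (k div d)" by simp
    then have "(monom 1 k :: int poly) = monom 1 (k mod d) * monom 1 d ^ (k div d)"
      by (simp add: monom_power mult_monom)
    then have "(monom 1 k :: int poly) - monom 1 (k mod d) = 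
        monom 1 (k mod d) * (monom 1 d ^ (k div d) - 1 ^ (k div d))"
      by (simp add: algebra_simps)
    moreover have "(monom 1 d :: int poly) - 1 dvd monom 1 d ^ (k div d) - 1 ^ (k div d)"
      unfolding power_diff_sumr2 by (rule dvd_triv_left)
    ultimately have "f dvd monom 1 k - monom 1 (k mod d)"
      using dvd_trans[OF assms(2)] by (simp add: dvd_mult)
    then have "f dvd pcompose f (monom 1 k) - pcompose f (monom 1 (k mod d))"
      by (rule dvd_trans[OF _ diff_dvd_pcompose_diff])
    from dvd_add[OF this R(1)[of "k mod d"]]
    show "f dvd pcompose f (monom 1 k) - R (k mod d)" by simp
  qed (rule R(2))
  define A where "A = nat (Max ((\<lambda>(k, i). \<bar>coeff (R k) i\<bar>) ` ({..<d} \<times> {..degree f})))"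
  have A: "\<bar>coeff (R k) i\<bar> \<le> int A" for k i
  proof (cases "i \<le> degree f")
    case True
    have "\<bar>coeff (R (k mod d)) i\<bar> \<le> Max ((\<lambda>(k, i). \<bar>coeff (R k) i\<bar>) ` ({..<d} \<times> {..degree f}))"
      using True assms(3) by (intro Max_ge) (force intro!: image_eqI[of _ _ "(k mod d, i)"])+
    then have "\<bar>coeff (R k) i\<bar> \<le> Max ((\<lambda>(k, i). \<bar>coeff (R k) i\<bar>) ` ({..<d} \<times> {..degree f}))"
      unfolding per[of k, symmetric] .
    then show ?thesis unfolding A_def by linarith
  next
    case False
    then have "coeff (R k) i = 0" using R(2)[of k] by (auto intro: coeff_eq_0)
    then show ?thesis by simp
  qed
  have "f dvd pcompose f (monom 1 p)" if p: "prime p" "p > A" for p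
  proof -
    have "p > 0" using p by simp
    obtain h where h: "pcompose f (monom 1 p) - f ^ p = of_nat p * h"
      using prime_dvd_pcompose_diff_power[OF p(1), of f] by (auto simp: dvd_def)
    obtain s where s: "f dvd h - s" "s = 0 \<or> degree s < degree f"
      using monic_remainder_exists[OF assms(1)] by blast
    \<comment> \<open>By the Frobenius congruence \<open>f(X^p)\<close> is
      \<open>f^p + p * h\<close>, hence congruent to \<open>p * s\<close> modulo \<open>f\<close>.
      Uniqueness of remainders then identifies \<open>R p\<close> with \<open>p * s\<close>.\<close>
    have "f dvd f ^ p + of_nat p * (h - s)"
      using s(1) \<open>p > 0\<close> by (intro dvd_add dvd_mult) (auto intro: dvd_power)
    also have "f ^ p + of_nat p * (h - s) = pcompose f (monom 1 p) - of_nat p * s"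
      using h by (simp add: algebra_simps)
    finally have "R p = of_nat p * s"
      using s(2) \<open>p > 0\<close> by (intro remainder_unique[OF R(1,2)]) (auto simp: of_nat_poly)
    then have Rp: "coeff (R p) i = int p * coeff s i" for i by (simp add: of_nat_poly)
    have "coeff (R p) i = 0" for i
    proof (rule ccontr)
      assume "coeff (R p) i \<noteq> 0"
      then have "\<bar>coeff s i\<bar> \<ge> 1" using Rp[of i] by auto
      then have "\<bar>coeff (R p) i\<bar> \<ge> int p * 1"
        unfolding Rp abs_mult by (intro mult_mono) auto
      then show False using A[of p i] p(2) by linarith
    qed
    then have "R p = 0" by (simp add: poly_eq_iff)
    then show ?thesis using R(1)[of p] by simp
  qed
  then show ?thesis by blast
qed

section \<open>Integer polynomials vanishing at a root of unity\<close>

text \<open>Gauss's lemma: contents are multiplicative, so \<open>c\<close> divides the content of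
  the cofactor and can be cancelled.\<close>

lemma dvd_smultD_content:
  fixes f g :: "int poly"
  assumes "content f = 1" "c \<noteq> 0" "f dvd smult c g"
  shows "f dvd g"
proof -
  obtain q where q: "smult c g = f * q" using assms(3) by (auto simp: dvd_def)
  have "content (smult c g) = content q" by (simp add: q content_mult assms(1))
  then have "c dvd content q" by (metis content_smult dvd_triv_left normalize_dvd_iff dvd_trans)
  then obtain q' where "q = [:c:] * q'"
    unfolding const_poly_dvd_iff_dvd_content[symmetric] by (auto simp: dvd_def)
  then have "smult c g = smult c (f * q')" using q by simp
  then have "g = f * q'" using assms(2) by (metis smult_cancel)
  then show ?thesis by simp
qed

text \<open>Since \<open>f\<close> divides \<open>f(X^q)\<close> for each large prime
  \<open>q\<close>, a root stays a root when raised to such a power. The prime factors of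
  \<open>m\<close> are split off one at a time.\<close>

lemma root_power_if_prime_factors_gt:
  fixes f :: "int poly" and z :: complex
  assumes A: "\<And>p. prime p \<Longrightarrow> p > A \<Longrightarrow> f dvd pcompose f (monom 1 p)"
    and "m > 0" "\<And>q. prime q \<Longrightarrow> q dvd m \<Longrightarrow> q > (A::nat)"
    and "poly (of_int_poly f) z = 0"
  shows "poly (of_int_poly f) (z ^ m) = 0"
  using assms(2-4)
proof (induction m arbitrary: z rule: less_induct)
  case (less m)
  show ?case
  proof (cases "m = 1")
    case False
    then obtain q where q: "prime q" "q dvd m" using prime_factor_nat by blast
    then obtain m' where m': "m = q * m'" by (auto simp: dvd_def)
    have "m' > 0" "m' < m" using m' less.prems(1) prime_gt_1_nat[OF q(1)] by auto
    have "(of_int_poly f :: complex poly) dvd of_int_poly (pcompose f (monom 1 q))"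
      using A[OF q(1) less.prems(2)[OF q]] by (rule of_int_poly_hom.hom_dvd)
    then have "poly (of_int_poly (pcompose f (monom 1 q))) z = 0"
      using less.prems(3) by (meson dvd_trans poly_eq_0_iff_dvd)
    then have "poly (of_int_poly f) (z ^ q) = 0"
      by (simp add: of_int_hom.map_poly_pcompose poly_pcompose poly_monom)
    then have "poly (of_int_poly f) ((z ^ q) ^ m') = 0"
      using less.IH[OF \<open>m' < m\<close> \<open>m' > 0\<close>] less.prems(2) m' by simp
    then show ?thesis by (simp add: m' power_mult)
  qed (use less.prems in simp)
qed

text \<open>An elementary substitute for Dirichlet's theorem on primes in progressions. Adding to
  \<open>j\<close> the product of \<open>d\<close> and the primes up to \<open>A\<close> that do not
  divide \<open>j\<close>, each prime up to \<open>A\<close> that divides \<open>j\<close> fails to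
  divide the added term, and every other one divides only that term; so none divides the
  sum.\<close>

lemma coprime_imp_cong_large_prime_factors:
  fixes j d A :: nat
  assumes "coprime j d" "d > 0"
  shows "\<exists>m>0. m mod d = j mod d \<and> (\<forall>q. prime q \<and> q dvd m \<longrightarrow> q > A)"
proof -
  define S where "S = {p. prime p \<and> p \<le> A \<and> \<not> p dvd j}"
  have fin: "finite S" unfolding S_def by (rule finite_subset[of _ "{..A}"]) auto
  define m where "m = j + d * \<Prod>S"
  have "\<Prod>S > 0" unfolding S_def by (intro prod_pos) (auto simp: prime_gt_0_nat)
  then have "m > 0" using assms(2) by (simp add: m_def)
  moreover have "m mod d = j mod d" by (simp add: m_def)
  moreover have "q > A" if q: "prime q" "q dvd m" for q
  proof (rule ccontr)
    assume "\<not> q > A"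
    show False
    proof (cases "q dvd j")
      case True
      then have "q dvd d * \<Prod>S" using q(2) by (simp add: m_def dvd_add_right_iff)
      then consider "q dvd d" | s where "s \<in> S" "q dvd s"
        using q(1) fin by (auto simp: prime_dvd_mult_iff prime_dvd_prod_iff)
      then show False
      proof cases
        case 1
        then show False using assms(1) True q(1) by (meson coprime_common_divisor not_prime_unit)
      next
        case 2
        then have "q = s" using q(1) primes_dvd_imp_eq by (auto simp: S_def)
        then show False using 2 True by (auto simp: S_def)
      qed
    next
      case False
      then have "q \<in> S" using q \<open>\<not> q > A\<close> by (simp add: S_def)
      then have "q dvd d * \<Prod>S" using fin dvd_prodI[of S q "\<lambda>x. x"] by (simp add: dvd_mult)
      then show False using False q(2) by (simp add: m_def dvd_add_left_iff)
    qed
  qed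
  ultimately show ?thesis by blast
qed

text \<open>The minimal polynomial of \<open>z\<close> divides \<open>X^d - 1\<close>, so by Gauss
  it can be taken monic and integral. It vanishes at \<open>z^m\<close> whenever all prime factors
  of \<open>m\<close> are large, and \<open>j\<close> is congruent modulo \<open>d\<close> to such
  an \<open>m\<close>. Finally \<open>F\<close> is a multiple of it up to a constant.\<close>

lemma int_poly_root_of_unity_power:
  fixes F :: "int poly" and z :: complex
  assumes F: "poly (of_int_poly F) z = 0" and z: "z ^ d = 1" "d > 0" and "coprime j d"
  shows "poly (of_int_poly F) (z ^ j) = 0"
proof -
  let ?e = "\<lambda>f. poly (of_int_poly f) z :: complex"
  let ?X = "monom 1 d - 1 :: int poly"
  have "coeff ?X d = 1" using z(2) by simp
  then have X0: "?X \<noteq> 0" by (metis coeff_0 zero_neq_one)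
  have degX: "degree ?X = d" using z(2)
    by (metis \<open>coeff ?X d = 1\<close> degree_1 degree_diff_le degree_monom_le le_antisym le_degree le_0_eq nat_le_linear zero_neq_one)
  have "?e ?X = 0" using z(1) by (simp add: hom_distribs poly_monom)
  then have ex: "?X \<noteq> 0 \<and> ?e ?X = 0" using X0 by simp
  \<comment> \<open>A minimal polynomial up to a constant factor; it is made primitive as
    \<open>g\<close> and then monic as \<open>h\<close>.\<close>
  define f where "f = (ARG_MIN degree f. f \<noteq> 0 \<and> ?e f = 0)"
  have f: "f \<noteq> 0" "?e f = 0" and min: "\<And>h. h \<noteq> 0 \<Longrightarrow> ?e h = 0 \<Longrightarrow> degree f \<le> degree h"
    using arg_min_nat_lemma[of "\<lambda>f. f \<noteq> 0 \<and> ?e f = 0", OF ex, of degree] unfolding f_def by blast+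
  define g where "g = primitive_part f"
  have fg: "f = smult (content f) g" by (simp add: g_def)
  have g: "g \<noteq> 0" "content g = 1" "degree g = degree f" using f(1) by (auto simp: g_def)
  have "?e g = 0" using f by (subst (asm) fg) (simp add: hom_distribs)
  \<comment> \<open>The pseudo-remainder vanishes at \<open>z\<close> and would have smaller degree
    than \<open>g\<close>, so it is zero by minimality.\<close>
  have div: "\<exists>c. c \<noteq> 0 \<and> g dvd smult c G" if "?e G = 0" for G
  proof -
    obtain c q where cq: "c \<noteq> 0" "smult c G = g * q + pseudo_mod G g"
      using pseudo_mod(1)[OF g(1), of G] by blast
    then have "pseudo_mod G g = smult c G - g * q" by simp
    then have "?e (pseudo_mod G g) = 0" using that \<open>?e g = 0\<close> by (simp add: hom_distribs)
    then have "pseudo_mod G g = 0"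
      using min[of "pseudo_mod G g"] pseudo_mod(2)[OF g(1), of G] g(3) by force
    then show ?thesis using cq by auto
  qed
  have gX: "g dvd ?X" using div[OF \<open>?e ?X = 0\<close>] dvd_smultD_content[OF g(2)] by blast
  then obtain q where q: "?X = g * q" by (auto simp: dvd_def)
  \<comment> \<open>As \<open>X^d - 1\<close> is monic, the leading coefficient of \<open>g\<close>
    is 1 or -1, and multiplying by it makes \<open>g\<close> monic.\<close>
  have "lead_coeff g * lead_coeff q = 1"
    using degX \<open>coeff ?X d = 1\<close> by (metis lead_coeff_mult q)
  then have lc: "lead_coeff g * lead_coeff g = 1" by (auto simp: zmult_eq_1_iff)
  define h where "h = smult (lead_coeff g) g"
  have hg: "g = smult (lead_coeff g) h" by (simp add: h_def lc)
  have "h dvd g" by (subst hg) (rule dvd_smult, rule dvd_refl)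
  have h: "lead_coeff h = 1" "?e h = 0" "h dvd ?X"
    using lc \<open>?e g = 0\<close> dvd_trans[OF \<open>h dvd g\<close> gX] by (auto simp: h_def hom_distribs)
  obtain A where A: "\<forall>p. prime p \<and> p > A \<longrightarrow> h dvd pcompose h (monom 1 p)"
    using monic_divisor_dvd_pcompose_monom[OF h(1,3) z(2)] by blast
  obtain m where m: "m > 0" "m mod d = j mod d" "\<And>q. prime q \<Longrightarrow> q dvd m \<Longrightarrow> q > A"
    using coprime_imp_cong_large_prime_factors[OF assms(4) z(2), of A] by blast
  have zmod: "z ^ k = z ^ (k mod d)" for k
    by (metis div_mult_mod_eq mult.commute mult_1 power_add power_mult power_one z(1))
  have "poly (of_int_poly h) (z ^ m) = 0"
    using A m h(2) by (intro root_power_if_prime_factors_gt[of A]) auto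
  then have hj: "poly (of_int_poly h) (z ^ j) = 0" using zmod[of m] zmod[of j] m(2) by simp
  obtain c where c: "c \<noteq> 0" "g dvd smult c F" using div[OF F] by blast
  have "(of_int_poly h :: complex poly) dvd of_int_poly (smult c F)"
    using dvd_trans[OF \<open>h dvd g\<close> c(2)] by (rule of_int_poly_hom.hom_dvd)
  then have "poly (of_int_poly (smult c F)) (z ^ j) = 0" using hj by (meson dvd_trans poly_eq_0_iff_dvd)
  then show ?thesis using c(1) by (simp add: hom_distribs)
qed

lemma rat_poly_clear_denominators:
  fixes p :: "rat poly"
  shows "\<exists>c F. c \<noteq> (0::int) \<and> smult (of_int c) p = of_int_poly F"
proof (induction p)
  case 0
  show ?case by (rule exI[of _ 1], rule exI[of _ 0]) simp
next
  case (pCons a p)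
  obtain c F where cF: "c \<noteq> 0" "smult (of_int c) p = of_int_poly F" using pCons.IH by blast
  obtain x y where xy: "quotient_of a = (x, y)" by force
  have y: "y > 0" "a = of_int x / of_int y"
    using quotient_of_denom_pos[OF xy] quotient_of_div[OF xy] by auto
  have "smult (of_int (y * c)) (pCons a p) = of_int_poly (pCons (c * x) (smult y F))"
    using y by (simp add: hom_distribs cF(2)[symmetric])
  then show ?case using cF(1) y(1) by (metis mult_eq_0_iff less_irrefl)
qed

lemma rat_poly_root_of_unity_power:
  fixes F :: "rat poly" and z :: complex
  assumes F: "poly (map_poly of_rat F) z = 0" and z: "z ^ d = 1" "d > 0" and "coprime j d"
  shows "poly (map_poly of_rat F) (z ^ j) = 0"
proof -
  obtain c G where cG: "c \<noteq> 0" "smult (of_int c) F = of_int_poly G"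
    using rat_poly_clear_denominators by blast
  have eq: "smult (of_int c) (map_poly of_rat F) = (of_int_poly G :: complex poly)"
    using arg_cong[OF cG(2), of "map_poly of_rat :: rat poly \<Rightarrow> complex poly"]
    by (simp add: hom_distribs map_poly_map_poly o_def)
  have "poly (of_int_poly G) z = 0" using F by (simp flip: eq)
  from int_poly_root_of_unity_power[OF this z assms(4)] show ?thesis
    using cG(1) by (simp flip: eq)
qed

section \<open>Degree of a rational polynomial with a root \<open>cos (pi * k / n)\<close>\<close>

text \<open>Equal powers force \<open>2 * n\<close> to divide \<open>k * (i - j)\<close>. For even
  \<open>n\<close> the number \<open>k\<close> is odd, hence coprime to \<open>2 * n\<close>. For
  odd \<open>n\<close> the number \<open>cis (pi * k / n)\<close> may have order only
  \<open>n\<close>; the missing factor 2 comes from \<open>i\<close> and \<open>j\<close> being odd,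
  as both are coprime to \<open>2 * n\<close>.\<close>

lemma cis_power_inject:
  fixes n k i j :: nat
  assumes "n > 0" "coprime k n" and i: "i \<in> totatives (2 * n)" and j: "j \<in> totatives (2 * n)"
    and eq: "cis (pi * k / n) ^ i = cis (pi * k / n) ^ j"
  shows "i = j"
proof -
  have "cis (real i * (pi * k / n) - real j * (pi * k / n)) = 1"
    using eq by (simp add: Complex.DeMoivre flip: cis_divide)
  then obtain l where "real i * (pi * k / n) - real j * (pi * k / n) = of_int l * (2 * pi)"
    unfolding cis_eq_1_iff by blast
  then have "pi * (real k * (real i - real j)) = pi * (of_int l * 2 * real n)"
    using \<open>n > 0\<close> by (simp add: field_simps)
  then have "real k * (real i - real j) = of_int l * 2 * real n" by simp
  then have "real_of_int (int k * (int i - int j)) = real_of_int (l * 2 * int n)" by simp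
  then have l: "int k * (int i - int j) = l * 2 * int n" by (rule of_int_eq_iff[THEN iffD1])
  have "int (2 * n) dvd int i - int j"
  proof (cases "even n")
    case True
    then have "coprime (2 * n) k" using assms(2)
      by (metis coprime_commute coprime_mult_left_iff coprime_divisors dvd_refl)
    then have "coprime (int (2 * n)) (int k)" by (simp only: coprime_int_iff)
    moreover have "int (2 * n) dvd int k * (int i - int j)" unfolding l by simp
    ultimately show ?thesis by (simp only: coprime_dvd_mult_right_iff)
  next
    case False
    have "coprime (int n) (int k)" using assms(2) by (simp add: coprime_commute)
    moreover have "int n dvd int k * (int i - int j)" unfolding l by simp
    ultimately have "int n dvd int i - int j" by (simp only: coprime_dvd_mult_right_iff)
    moreover have "odd i" "odd j" using i j by (auto simp: in_totatives_iff)
    then have "2 dvd int i - int j" by simp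
    moreover have "coprime (2::int) (int n)" using False by simp
    ultimately have "2 * int n dvd int i - int j" by (intro divides_mult)
    then show ?thesis by simp
  qed
  moreover have "\<bar>int i - int j\<bar> < int (2 * n)"
    using i j by (auto simp: in_totatives_iff)
  ultimately show ?thesis
    by (metis dvd_imp_le_int abs_of_nat eq_iff_diff_eq_0 linorder_not_le of_nat_eq_iff)
qed

text \<open>With \<open>2 * cos x = z + 1 / z\<close> for \<open>z = cis x\<close>, the polynomial \<open>(2 * X) ^ degree h * h ((X + 1 / X) / 2)\<close>
  has degree \<open>2 * degree h\<close> and vanishes at all conjugates of \<open>z\<close>.\<close>
lemma totient_le_degree_if_root_cos:
  fixes h :: "rat poly" and n k :: nat
  assumes "h \<noteq> 0" "n > 0" "coprime k n"
    and root: "poly (map_poly of_rat h) (complex_of_real (cos (pi * k / n))) = 0"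
  shows "totient (2 * n) \<le> 2 * degree h"
proof -
  define m where "m = degree h"
  define t where "t = (\<lambda>i. smult (coeff h i) ([:1, 0, 1:] ^ i * [:0, 2:] ^ (m - i)))"
  define F where "F = (\<Sum>i\<le>m. t i)"
  define G where "G = map_poly (of_rat :: rat \<Rightarrow> complex) F"
  have degt: "degree (t i) \<le> m + i" if "i \<le> m" for i
  proof -
    have "degree (t i) \<le> degree ([:1, 0, 1:] ^ i :: rat poly) + degree ([:0, 2:] ^ (m - i) :: rat poly)"
      unfolding t_def using degree_smult_le degree_mult_le order_trans by blast
    also have "\<dots> = 2 * i + (m - i)" by (simp add: degree_power_eq)
    finally show ?thesis using that by simp
  qed
  \<comment> \<open>Only the summand for \<open>i = m\<close> reaches degree \<open>2 * m\<close>,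
    where it contributes the leading coefficient of \<open>h\<close>. This shows that
    \<open>F\<close> is nonzero.\<close>
  have "coeff F (2 * m) = (\<Sum>i\<le>m. coeff (t i) (2 * m))" by (simp add: F_def coeff_sum)
  also have "\<dots> = (\<Sum>i\<in>{m}. coeff (t i) (2 * m))"
  proof (rule sum.mono_neutral_right)
    show "\<forall>i\<in>{..m} - {m}. coeff (t i) (2 * m) = 0"
    proof
      fix i assume "i \<in> {..m} - {m}"
      then have "degree (t i) < 2 * m" using degt[of i] by auto
      then show "coeff (t i) (2 * m) = 0" by (rule coeff_eq_0)
    qed
  qed auto
  also have "\<dots> = lead_coeff h * coeff ([:1, 0, 1:] ^ m) (2 * m)" by (simp add: t_def m_def)
  also have "coeff ([:1, 0, 1:] ^ m :: rat poly) (2 * m) = lead_coeff ([:1, 0, 1:] ^ m)"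
    by (simp add: degree_power_eq mult_2 mult_2_right)
  also have "\<dots> = 1" by (simp add: lead_coeff_power)
  finally have "F \<noteq> 0" using assms(1) by auto
  then have "G \<noteq> 0" by (simp add: G_def)
  have degF: "degree F \<le> 2 * m"
    unfolding F_def using degt by (intro degree_sum_le) force+
  define z where "z = cis (pi * k / n)"
  have cosz: "z\<^sup>2 + 1 = 2 * z * complex_of_real (cos (pi * k / n))"
  proof -
    have "z + inverse z = 2 * complex_of_real (cos (pi * k / n))"
      by (simp add: z_def complex_eq_iff)
    then have "z * (z + inverse z) = z * (2 * complex_of_real (cos (pi * k / n)))" by simp
    moreover have "z \<noteq> 0" by (simp add: z_def)
    ultimately show ?thesis by (simp add: algebra_simps power2_eq_square)
  qed
  have "poly G z = (\<Sum>i\<le>m. of_rat (coeff h i) * ((z\<^sup>2 + 1) ^ i * (2 * z) ^ (m - i)))"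
    by (simp add: G_def F_def t_def of_rat_poly_hom.hom_sum of_rat_poly_hom.hom_mult
        of_rat_poly_hom.hom_power of_rat_hom.map_poly_hom_smult of_rat_hom.map_poly_pCons_hom
        poly_sum power2_eq_square mult.commute add.commute)
  also have "\<dots> = (\<Sum>i\<le>m. (2 * z) ^ m * (of_rat (coeff h i) * of_real (cos (pi * k / n)) ^ i))"
  proof (rule sum.cong)
    fix i assume "i \<in> {..m}"
    then have zm: "(2 * z) ^ m = (2 * z) ^ i * (2 * z) ^ (m - i)"
      by (metis atMost_iff le_add_diff_inverse power_add)
    show "of_rat (coeff h i) * ((z\<^sup>2 + 1) ^ i * (2 * z) ^ (m - i)) =
        (2 * z) ^ m * (of_rat (coeff h i) * of_real (cos (pi * k / n)) ^ i)"
      unfolding cosz zm power_mult_distrib[of "2 * z"] by (simp only: mult_ac)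
  qed simp
  also have "\<dots> = (2 * z) ^ m * poly (map_poly of_rat h) (of_real (cos (pi * k / n)))"
    by (simp add: poly_altdef m_def sum_distrib_left)
  finally have "poly G z = 0" using root by simp
  moreover have "z ^ (2 * n) = 1"
  proof -
    have "z ^ (2 * n) = cis (of_int (int k) * (2 * pi))"
      unfolding z_def Complex.DeMoivre using assms(2) by (simp add: field_simps)
    then show ?thesis unfolding cis_eq_1_iff[THEN iffD2, OF exI, OF refl] .
  qed
  ultimately have "poly G (z ^ j) = 0" if "j \<in> totatives (2 * n)" for j
    unfolding G_def using that assms(2)
    by (intro rat_poly_root_of_unity_power[of F z "2 * n"]) (auto simp: in_totatives_iff)
  \<comment> \<open>These powers are pairwise distinct by \<open>cis_power_inject\<close>, so
    \<open>G\<close> has at least \<open>totient (2 * n)\<close> roots.\<close>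
  then have "(\<lambda>j. z ^ j) ` totatives (2 * n) \<subseteq> {x. poly G x = 0}" by blast
  then have "card ((\<lambda>j. z ^ j) ` totatives (2 * n)) \<le> card {x. poly G x = 0}"
    using \<open>G \<noteq> 0\<close> by (intro card_mono poly_roots_finite)
  also have "\<dots> \<le> degree G" using \<open>G \<noteq> 0\<close> by (rule card_poly_roots_bound)
  also have "\<dots> = degree F" by (simp add: G_def)
  finally have "card ((\<lambda>j. z ^ j) ` totatives (2 * n)) \<le> 2 * m" using degF by simp
  moreover have "inj_on (\<lambda>j. z ^ j) (totatives (2 * n))"
    unfolding z_def inj_on_def using cis_power_inject[OF assms(2,3)] by blast
  ultimately show ?thesis by (simp add: card_image totient_def m_def)
qed

section \<open>Passing from a root of \<open>P\<close> to the value of \<open>u\<close>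
  there\<close>

lemma pcompose_monom: "pcompose (monom c i) u = smult c (u ^ i)"
  by (induction i) (simp_all add: monom_0 monom_Suc pcompose_pCons mult.commute)

text \<open>The residues of the powers \<open>u^0, ..., u^m\<close> modulo \<open>P\<close>, with
  \<open>m\<close> the degree of \<open>P\<close>, are \<open>m + 1\<close> vectors in a space of
  dimension \<open>m\<close>; a linear relation among them gives the coefficients of
  \<open>h\<close>.\<close>

lemma exists_pcompose_multiple:
  fixes P u :: "'a::field poly"
  assumes "P \<noteq> 0"
  shows "\<exists>h. h \<noteq> 0 \<and> degree h \<le> degree P \<and> P dvd pcompose h u"
proof -
  interpret vs: vector_space "smult :: 'a \<Rightarrow> 'a poly \<Rightarrow> 'a poly"
    by unfold_locales (simp_all add: smult_add_right smult_add_left)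
  define m where "m = degree P"
  define f where "f = (\<lambda>i. u ^ i mod P)"
  have f: "P dvd u ^ i - f i" for i by (simp add: f_def minus_mod_eq_mult_div)
  define B where "B = (\<lambda>i. monom (1::'a) i) ` {..<m}"
  have span: "f i \<in> vs.span B" for i
  proof -
    have deg: "f i = 0 \<or> degree (f i) < m"
      unfolding f_def m_def by (rule degree_mod_less[OF assms])
    have "f i = (\<Sum>j<m. smult (coeff (f i) j) (monom 1 j))"
    proof (rule poly_eqI)
      fix l show "coeff (f i) l = coeff (\<Sum>j<m. smult (coeff (f i) j) (monom 1 j)) l"
        using deg by (cases "f i = 0") (auto simp: coeff_sum if_distrib cong: if_cong intro!: coeff_eq_0)
    qed
    also have "\<dots> \<in> vs.span B"
      by (intro vs.span_sum vs.span_scale vs.span_base) (auto simp: B_def)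
    finally show ?thesis .
  qed
  show ?thesis
  \<comment> \<open>Linear dependence is stated for sets, in which a repeated residue would
    collapse. A repetition yields \<open>h\<close> directly as a difference of two
    monomials.\<close>
  proof (cases "inj_on f {..m}")
    case False
    then obtain i j where ij: "i \<le> m" "j \<le> m" "i < j" "f i = f j"
      unfolding inj_on_def by (metis atMost_iff linorder_neqE_nat)
    define h where "h = monom 1 j - monom (1::'a) i"
    have "coeff h j = 1" using ij by (simp add: h_def)
    then have "h \<noteq> 0" by auto
    moreover have "degree h \<le> m"
      unfolding h_def using ij by (intro degree_diff_le) (auto intro: order_trans[OF degree_monom_le])
    moreover have "pcompose h u = (u ^ j - f j) - (u ^ i - f i)"
      using ij(4) by (simp add: h_def pcompose_diff pcompose_monom)
    then have "P dvd pcompose h u" using dvd_diff[OF f f] by simp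
    ultimately show ?thesis unfolding m_def by blast
  next
    case True
    have "vs.dependent (f ` {..m})"
    proof (rule ccontr)
      assume "\<not> vs.dependent (f ` {..m})"
      then have "card (f ` {..m}) \<le> card B"
        using vs.independent_span_bound[of B "f ` {..m}"] span by (auto simp: B_def)
      also have "\<dots> \<le> m" unfolding B_def using card_image_le[of "{..<m}"] by simp
      finally show False using card_image[OF True] by simp
    qed
    then obtain c v where c: "v \<in> f ` {..m}" "c v \<noteq> 0" "(\<Sum>v\<in>f ` {..m}. smult (c v) v) = 0"
      using vs.dependent_finite[of "f ` {..m}"] by auto
    then have s: "(\<Sum>i\<le>m. smult (c (f i)) (f i)) = 0" by (simp add: sum.reindex[OF True])
    define h where "h = (\<Sum>i\<le>m. monom (c (f i)) i)"
    have coeff_h: "coeff h i = c (f i)" if "i \<le> m" for i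
      using that by (simp add: h_def coeff_sum)
    obtain i where "i \<le> m" "v = f i" using c(1) by auto
    then have "h \<noteq> 0" using coeff_h c(2) by (metis coeff_0)
    moreover have "degree h \<le> m"
      unfolding h_def by (intro degree_sum_le) (auto intro: order_trans[OF degree_monom_le])
    moreover have "pcompose h u = (\<Sum>i\<le>m. smult (c (f i)) (u ^ i - f i))"
      using s by (simp add: h_def pcompose_sum pcompose_monom smult_diff_right sum_subtractf)
    then have "P dvd pcompose h u" by (auto intro: dvd_sum dvd_smult f)
    ultimately show ?thesis unfolding m_def by blast
  qed
qed

text \<open>The number \<open>u(\<alpha>)\<close> lies in the field generated by
  \<open>\<alpha>\<close>, so its degree is at most that of \<open>P\<close>; the polynomial
  \<open>h\<close> is a concrete witness of this.\<close>

lemma totient_le_degree_if_root_comp_cos: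
  fixes P u :: "rat poly" and n k :: nat and \<alpha> :: complex
  assumes "P \<noteq> 0" "n > 0" "coprime k n"
    and \<alpha>: "poly (map_poly of_rat P) \<alpha> = 0"
    and u: "poly (map_poly of_rat u) \<alpha> = complex_of_real (cos (pi * k / n))"
  shows "totient (2 * n) \<le> 2 * degree P"
proof -
  obtain h where h: "h \<noteq> 0" "degree h \<le> degree P" "P dvd pcompose h u"
    using exists_pcompose_multiple[OF assms(1)] by blast
  have "poly (map_poly of_rat (pcompose h u)) \<alpha> = 0"
    using \<alpha> of_rat_poly_hom.hom_dvd[OF h(3)] by (meson dvd_trans poly_eq_0_iff_dvd)
  then have "poly (map_poly of_rat h) (complex_of_real (cos (pi * k / n))) = 0"
    by (simp add: of_rat_hom.map_poly_pcompose poly_pcompose u)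
  from totient_le_degree_if_root_cos[OF h(1) assms(2,3) this] h(2) show ?thesis by simp
qed

section \<open>Chebyshev polynomials of the second kind\<close>

text \<open>Indexed such that \<open>cheb n\<close> is \<open>U\<^bsub>n - 1\<^esub>\<close>.\<close>
fun cheb :: "nat \<Rightarrow> 'a::comm_ring_1 poly" where
  "cheb 0 = 0"
| "cheb (Suc 0) = 1"
| "cheb (Suc (Suc n)) = [:0, 2:] * cheb (Suc n) - cheb n"

lemma map_poly_of_rat_cheb:
  "map_poly (of_rat :: rat \<Rightarrow> 'a::field_char_0) (cheb n) = cheb n"
  by (induction n rule: cheb.induct)
    (simp_all only: cheb.simps of_rat_poly_hom.hom_minus of_rat_poly_hom.hom_mult
      of_rat_poly_hom.hom_zero of_rat_poly_hom.hom_one, simp_all)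

text \<open>The element \<open>u + v * sqrt D\<close> has trace \<open>2 * u\<close> and norm 1, so
  both sequences satisfy the recurrence \<open>x (n + 2) = 2 * u * x (n + 1) - x n\<close>.\<close>

lemma pell_v_eq_cheb:
  assumes "pell_solution D u v"
  shows "pell_v D u v n = v * pcompose (cheb n) u"
proof (induction n rule: cheb.induct)
  case (3 n)
  let ?U = "pell_u D u v" and ?V = "pell_v D u v"
  have V: "?V (Suc m) = u * ?V m + v * ?U m" and U: "?U (Suc m) = u * ?U m + D * v * ?V m" for m
    by (simp_all add: pell_u_def pell_v_def sqrt_mult_def)
  have "?V (Suc (Suc n)) = 2 * u * ?V (Suc n) - (u ^ 2 - D * v ^ 2) * ?V n"
    unfolding V[of "Suc n"] U V[of n] by (simp add: algebra_simps power2_eq_square)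
  also have "\<dots> = 2 * u * ?V (Suc n) - ?V n"
    using assms by (simp add: pell_solution_def)
  also have "\<dots> = v * (2 * u * pcompose (cheb (Suc n)) u - pcompose (cheb n) u)"
    unfolding 3 by (simp add: algebra_simps)
  also have "2 * u = pcompose [:0, 2:] u" by (simp add: pcompose_pCons numeral_poly)
  finally show ?case
    unfolding cheb.simps pcompose_diff pcompose_mult .
qed (simp_all add: pell_v_def sqrt_mult_def pcompose_1)

lemma degree_cheb_Suc: "degree (cheb (Suc n) :: 'a::comm_ring_1 poly) \<le> n"
proof (induction n rule: induct_nat_012)
  case (ge2 n)
  have "degree ([:0, 2:] * cheb (Suc (Suc n)) :: 'a poly) \<le> 1 + Suc n"
    by (rule order_trans[OF degree_mult_le add_mono[OF _ ge2(2)]]) auto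
  then show ?case using ge2(1) unfolding cheb.simps(3)[of "Suc n"]
    by (intro degree_diff_le) auto
qed auto

lemma coeff_cheb_Suc: "coeff (cheb (Suc n) :: 'a::comm_ring_1 poly) n = 2 ^ n"
proof (induction n rule: induct_nat_012)
  case (ge2 n)
  have "coeff (cheb (Suc n) :: 'a poly) (Suc (Suc n)) = 0"
    using degree_cheb_Suc[of n, where ?'a = 'a] by (intro coeff_eq_0) simp
  then show ?case using ge2 unfolding cheb.simps(3)[of "Suc n"] by simp
qed auto

lemma poly_cheb_cos:
  "poly (cheb n) (complex_of_real (cos x)) * of_real (sin x) = of_real (sin (real n * x))"
proof (induction n rule: cheb.induct)
  case (3 n)
  have "sin (real (Suc (Suc n)) * x) = 2 * cos x * sin (real (Suc n) * x) - sin (real n * x)"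
    using sin_add[of "real (Suc n) * x" x] sin_diff[of "real (Suc n) * x" x]
    by (simp add: algebra_simps)
  then have "complex_of_real (sin (real (Suc (Suc n)) * x)) =
      2 * of_real (cos x) * of_real (sin (real (Suc n) * x)) - of_real (sin (real n * x))"
    by (simp only: of_real_diff of_real_mult of_real_numeral)
  moreover have "poly (cheb (Suc (Suc n))) (complex_of_real (cos x)) * of_real (sin x) =
      2 * of_real (cos x) * (poly (cheb (Suc n)) (of_real (cos x)) * of_real (sin x)) -
      poly (cheb n) (of_real (cos x)) * of_real (sin x)"
    by (simp add: left_diff_distrib mult.assoc)
  ultimately show ?case unfolding 3 by (simp only:)
qed simp_all

section \<open>Factorisation of the Chebyshev polynomials by fractions in lowest terms\<close>

text \<open>The leading coefficient 2 makes products of these factors match the leading coefficient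
  \<open>2^(n - 1)\<close> of \<open>cheb n\<close>. For positive \<open>n\<close> the factor
  depends only on the fraction \<open>j / n\<close>.\<close>

definition cos_linear :: "nat \<Rightarrow> nat \<Rightarrow> complex poly" where
  "cos_linear n j = [:- 2 * of_real (cos (pi * j / n)), 2:]"

text \<open>Both sides have degree at most \<open>n - 1\<close>, the same coefficient there, and
  vanish at the \<open>n - 1\<close> numbers \<open>cos (pi * j / n)\<close>, which are distinct
  since cosine is injective between 0 and pi. For \<open>cheb n\<close> the zeros come from
  \<open>sin (n * x) = 0\<close> with \<open>sin x\<close> nonzero.\<close>

lemma cheb_eq_prod_cos_linear:
  assumes "n > 0"
  shows "cheb n = (\<Prod>j\<in>{0<..<n}. cos_linear n j)"
proof -
  obtain m where n: "n = Suc m" using assms by (cases n) auto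
  define c where "c = (\<lambda>j. complex_of_real (cos (pi * j / n)))"
  have bnd: "0 < pi * j / n" "pi * j / n < pi" if "j \<in> {0<..<n}" for j
  proof -
    have "real j / real n < 1" using that by simp
    then have "pi * (real j / real n) < pi * 1" by (intro mult_strict_left_mono) simp_all
    then show "pi * j / n < pi" by simp
    show "0 < pi * j / n" using that by simp
  qed
  have inj: "inj_on c {0<..<n}"
  proof (rule inj_onI)
    fix i j assume ij: "i \<in> {0<..<n}" "j \<in> {0<..<n}" "c i = c j"
    then have "cos (pi * i / n) = cos (pi * j / n)" by (simp add: c_def)
    then have "pi * i / n = pi * j / n"
      by (rule cos_inj_pi[rotated 4]) (use bnd[OF ij(1)] bnd[OF ij(2)] in linarith)+
    then show "i = j" using assms by simp
  qed
  show ?thesis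
  proof (rule poly_eqI_degree_lead_coeff[of _ m _ "c ` {0<..<n}"])
    show "degree (cheb n :: complex poly) \<le> m" unfolding n by (rule degree_cheb_Suc)
    have lin: "cos_linear n j \<noteq> 0" "degree (cos_linear n j) = 1" "lead_coeff (cos_linear n j) = 2" for j
      by (simp_all add: cos_linear_def)
    have "degree (\<Prod>j\<in>{0<..<n}. cos_linear n j) = (\<Sum>j\<in>{0<..<n}. degree (cos_linear n j))"
      by (rule degree_prod_eq_sum_degree) (simp add: lin(1))
    then have deg: "degree (\<Prod>j\<in>{0<..<n}. cos_linear n j) = m" by (simp add: lin(2)) (simp add: n)
    then show "degree (\<Prod>j\<in>{0<..<n}. cos_linear n j) \<le> m" by simp
    have "lead_coeff (\<Prod>j\<in>{0<..<n}. cos_linear n j) = 2 ^ m"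
      unfolding lead_coeff_prod lin(3) by (simp add: n)
    then show "coeff (cheb n) m = coeff (\<Prod>j\<in>{0<..<n}. cos_linear n j) m"
      unfolding deg using coeff_cheb_Suc[of m, where ?'a = complex] by (simp only: n)
    show "m \<le> card (c ` {0<..<n})" using card_image[OF inj] by (simp add: n)
    fix x assume "x \<in> c ` {0<..<n}"
    then obtain j where j: "j \<in> {0<..<n}" "x = c j" by auto
    have "sin (pi * j / n) > 0" using bnd[OF j(1)] by (rule sin_gt_zero)
    moreover have "sin (real n * (pi * j / n)) = 0" using assms by simp
    ultimately have "poly (cheb n) x = 0"
      using poly_cheb_cos[of n "pi * j / n"] unfolding j(2) c_def by simp
    moreover have "poly (\<Prod>j\<in>{0<..<n}. cos_linear n j) x = 0"
      using j by (auto simp: poly_prod cos_linear_def c_def)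
    ultimately show "poly (cheb n) x = poly (\<Prod>j\<in>{0<..<n}. cos_linear n j) x" by simp
  qed
qed

text \<open>Removing \<open>n\<close> has an effect only for \<open>n = 1\<close>, where
  \<open>totatives 1\<close> is \<open>{1}\<close>; it makes the first new factor trivial.\<close>

definition cos_new :: "nat \<Rightarrow> complex poly" where
  "cos_new n = (\<Prod>k\<in>totatives n - {n}. cos_linear n k)"

text \<open>Each fraction \<open>j / n\<close> strictly between 0 and 1 has a unique form
  \<open>k / m\<close> in lowest terms, with \<open>m\<close> dividing \<open>n\<close>. Grouping
  the linear factors by the reduced denominator \<open>m\<close> gives the product.\<close>

lemma prod_cos_new_eq_cheb:
  assumes "n > 0"
  shows "(\<Prod>m | m dvd n. cos_new m) = cheb n"
proof -
  have "(\<Prod>m | m dvd n. cos_new m) =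
      (\<Prod>(m, k)\<in>(SIGMA m:{m. m dvd n}. totatives m - {m}). cos_linear m k)"
    unfolding cos_new_def using assms by (intro prod.Sigma) auto
  also have "\<dots> = (\<Prod>j\<in>{0<..<n}. cos_linear n j)"
  proof (rule prod.reindex_bij_witness[where i = "\<lambda>j. (n div gcd j n, j div gcd j n)"
          and j = "\<lambda>(m, k). k * (n div m)"])
    fix a assume "a \<in> (SIGMA m:{m. m dvd n}. totatives m - {m})"
    then obtain m k where mk: "a = (m, k)" "m dvd n" "k \<in> totatives m" "k \<noteq> m" by auto
    have "0 < k" "k \<le> m" "coprime k m" using mk(3) unfolding in_totatives_iff by auto
    with mk have a: "a = (m, k)" "m dvd n" "0 < k" "k < m" "coprime k m" by simp_all
    then obtain d where d: "n = m * d" by (auto simp: dvd_def)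
    have "m > 0" "d > 0" using assms d by auto
    have g: "gcd (k * d) (m * d) = d" using a(5) by (simp add: gcd_mult_distrib_nat[symmetric] mult.commute[of _ d])
    show "(case a of (m, k) \<Rightarrow> k * (n div m)) \<in> {0<..<n}"
      using a \<open>m > 0\<close> \<open>d > 0\<close> by (simp add: d)
    show "(n div gcd (case a of (m, k) \<Rightarrow> k * (n div m)) n,
        (case a of (m, k) \<Rightarrow> k * (n div m)) div gcd (case a of (m, k) \<Rightarrow> k * (n div m)) n) = a"
      using a(1) \<open>m > 0\<close> \<open>d > 0\<close> g by (simp add: d)
    show "cos_linear n (case a of (m, k) \<Rightarrow> k * (n div m)) = (case a of (m, k) \<Rightarrow> cos_linear m k)"
      using a(1) \<open>m > 0\<close> \<open>d > 0\<close> by (simp add: d cos_linear_def)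
  next
    fix j assume j: "j \<in> {0<..<n}"
    define g where "g = gcd j n"
    have "g > 0" using assms by (simp add: g_def)
    have "coprime (j div g) (n div g)"
      unfolding g_def using assms by (intro div_gcd_coprime) simp
    moreover have "g dvd j" "g dvd n" by (simp_all add: g_def)
    moreover have "0 < j div g"
      using j \<open>g > 0\<close> \<open>g dvd j\<close> by (simp add: div_greater_zero_iff dvd_imp_le)
    moreover have "j div g < n div g"
      using j \<open>g dvd n\<close> by (intro div_less_mono) (auto simp: g_def)
    ultimately show "(n div gcd j n, j div gcd j n) \<in> (SIGMA m:{m. m dvd n}. totatives m - {m})"
      unfolding g_def[symmetric] by (auto simp: in_totatives_iff)
    have "n div (n div g) = g"
      using \<open>g dvd n\<close> \<open>g > 0\<close> assms by (auto elim!: dvdE)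
    then show "(case (n div gcd j n, j div gcd j n) of (m, k) \<Rightarrow> k * (n div m)) = j"
      unfolding g_def[symmetric] using \<open>g dvd j\<close> by simp
  qed
  also have "\<dots> = cheb n" by (rule cheb_eq_prod_cos_linear[OF assms, symmetric])
  finally show ?thesis .
qed

lemma cos_new_nonzero: "cos_new n \<noteq> 0"
  by (auto simp: cos_new_def cos_linear_def)

lemma degree_cos_new:
  assumes "n \<ge> 2"
  shows "degree (cos_new n) = totient n"
proof -
  have "n \<notin> totatives n" using assms by (auto simp: in_totatives_iff)
  then have "cos_new n = (\<Prod>k\<in>totatives n. cos_linear n k)" by (simp add: cos_new_def)
  also have "degree \<dots> = (\<Sum>k\<in>totatives n. degree (cos_linear n k))"
    by (rule degree_prod_eq_sum_degree) (simp add: cos_linear_def)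
  also have "\<dots> = totient n" by (simp add: cos_linear_def totient_def)
  finally show ?thesis .
qed

lemma cos_new_1: "cos_new (Suc 0) = 1"
  by (simp add: cos_new_def)

text \<open>By induction the factors for proper divisors are rational, and \<open>cos_new n\<close>
  is the quotient of the rational polynomial \<open>cheb n\<close> by their product. Divisibility
  over the complex numbers descends to the rationals.\<close>

lemma cos_new_rat: "n > 0 \<Longrightarrow> \<exists>p :: rat poly. map_poly of_rat p = cos_new n"
proof (induction n rule: less_induct)
  case (less n)
  let ?M = "{m. m dvd n \<and> m \<noteq> n}"
  have "\<exists>p :: rat poly. map_poly of_rat p = cos_new m" if "m \<in> ?M" for m
  proof (rule less.IH)
    show "m > 0" using that less.prems dvd_pos_nat[of n m] by simp
    show "m < n" using that dvd_imp_le[OF _ less.prems, of m] by simp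
  qed
  then have "\<forall>m\<in>?M. \<exists>p :: rat poly. map_poly of_rat p = cos_new m" by blast
  from bchoice[OF this] obtain q :: "nat \<Rightarrow> rat poly"
    where q: "\<And>m. m \<in> ?M \<Longrightarrow> map_poly of_rat (q m) = cos_new m" by blast
  define Q where "Q = (\<Prod>m\<in>?M. q m)"
  have fin: "finite {m. m dvd n}" using less.prems by simp
  have Q: "map_poly of_rat Q = (\<Prod>m\<in>?M. cos_new m)"
    unfolding Q_def of_rat_poly_hom.hom_prod using q by (rule prod.cong[OF refl])
  have finM: "finite ?M" using fin by (rule rev_finite_subset) blast
  then have Q0: "map_poly of_rat Q \<noteq> (0 :: complex poly)"
    unfolding Q using cos_new_nonzero by simp
  have "{m. m dvd n} = insert n ?M" by auto
  then have "(\<Prod>m | m dvd n. cos_new m) = cos_new n * map_poly of_rat Q"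
    unfolding Q using finM by simp
  then have eq: "cheb n = map_poly of_rat Q * cos_new n"
    using prod_cos_new_eq_cheb[OF less.prems] by (simp add: mult.commute)
  have "(map_poly of_rat Q :: complex poly) dvd map_poly of_rat (cheb n)"
    unfolding map_poly_of_rat_cheb eq by simp
  then have "Q dvd cheb n" by (rule of_rat_hom.dvd_map_poly_hom_imp_dvd)
  then obtain r where r: "cheb n = Q * r" by (auto simp: dvd_def)
  have "map_poly of_rat Q * cos_new n = map_poly of_rat (cheb n)"
    unfolding map_poly_of_rat_cheb eq ..
  also have "\<dots> = map_poly of_rat Q * map_poly of_rat r"
    unfolding r of_rat_poly_hom.hom_mult ..
  finally have "map_poly of_rat r = cos_new n"
    using Q0 by simp
  then show ?case by blast
qed

section \<open>Counting\<close>

text \<open>By multiplicativity this reduces to odd prime powers, where it follows from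
  \<open>p \<le> (p - 1)^2\<close> for \<open>p \<ge> 3\<close>.\<close>

lemma le_totient_square_if_odd:
  fixes n :: nat
  assumes "odd n"
  shows "n \<le> totient n ^ 2"
  using assms
proof (induction n rule: less_induct)
  case (less n)
  show ?case
  proof (cases "n = 1")
    case False
    then obtain p where p: "prime p" "p dvd n" using prime_factor_nat by blast
    have "n > 0" using less.prems odd_pos by blast
    define e where "e = multiplicity p n"
    obtain m where m: "n = p ^ e * m" "\<not> p dvd m"
      using multiplicity_decompose'[of n p] \<open>n > 0\<close> p(1) e_def
      by (metis not_prime_unit not_gr0)
    have "e > 0" using p \<open>n > 0\<close> by (simp add: e_def prime_multiplicity_gt_zero_iff)
    then obtain f where f: "e = Suc f" by (cases e) auto
    have "odd p" using p(2) less.prems by auto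
    then have "p \<ge> 3" using prime_ge_2_nat[OF p(1)] by (cases "p = 2") auto
    then obtain r where r: "p = r + 3" by (metis le_iff_add add.commute)
    have "p \<le> (p - 1) ^ 2" unfolding r by (simp add: power2_eq_square algebra_simps)
    then have "p ^ f * p \<le> p ^ (2 * f) * (p - 1) ^ 2"
      using \<open>p \<ge> 3\<close> by (intro mult_mono power_increasing) auto
    also have "\<dots> = totient (p ^ e) ^ 2"
      unfolding f totient_prime_power_Suc[OF p(1)] by (simp add: power_mult_distrib power_mult mult.commute)
    finally have 1: "p ^ e \<le> totient (p ^ e) ^ 2" by (simp add: f mult.commute)
    have "odd m" using less.prems m(1) by auto
    have "m > 0" using \<open>n > 0\<close> m(1) by auto
    then have "1 * m < p ^ e * m" using \<open>e > 0\<close> prime_gt_1_nat[OF p(1)]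
      by (intro mult_strict_right_mono one_less_power) auto
    then have 2: "m \<le> totient m ^ 2" using m(1) \<open>odd m\<close> by (intro less.IH) auto
    have "coprime (p ^ e) m" using p(1) m(2) by (simp add: prime_imp_coprime)
    then have "totient n ^ 2 = totient (p ^ e) ^ 2 * totient m ^ 2"
      unfolding m(1) by (simp add: totient_mult_coprime power_mult_distrib)
    then show ?thesis unfolding m(1) using mult_le_mono[OF 1 2] by simp
  qed simp
qed

text \<open>A prime factor \<open>p \<ge> 5\<close> gains the factor 2 through
  \<open>2 * p \<le> (p - 1)^2\<close>. Otherwise \<open>n\<close> is a power of 3 with exponent at
  least 2, and the totient is explicit. The inequality fails for 1 and 3.\<close>

lemma double_le_totient_square_if_odd:
  fixes n :: nat
  assumes "odd n" "n \<noteq> 1" "n \<noteq> 3"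
  shows "2 * n \<le> totient n ^ 2"
proof (cases "\<exists>p. prime p \<and> p dvd n \<and> p \<noteq> 3")
  case True
  then obtain p where p: "prime p" "p dvd n" "p \<noteq> 3" by blast
  have "n > 0" using assms(1) odd_pos by blast
  define e where "e = multiplicity p n"
  obtain m where m: "n = p ^ e * m" "\<not> p dvd m"
    using multiplicity_decompose'[of n p] \<open>n > 0\<close> p(1) e_def
    by (metis not_prime_unit not_gr0)
  have "e > 0" using p \<open>n > 0\<close> by (simp add: e_def prime_multiplicity_gt_zero_iff)
  then obtain f where f: "e = Suc f" by (cases e) auto
  have "odd p" using p(2) assms(1) by auto
  then have "p \<noteq> 2" "p \<noteq> 4" by auto
  then have "p \<ge> 5" using prime_ge_2_nat[OF p(1)] p(3) by linarith
  then obtain r where r: "p = r + 5" by (metis le_iff_add add.commute)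
  have "2 * p \<le> (p - 1) ^ 2" unfolding r by (simp add: power2_eq_square algebra_simps)
  then have "p ^ f * (2 * p) \<le> p ^ (2 * f) * (p - 1) ^ 2"
    using \<open>p \<ge> 5\<close> by (intro mult_mono power_increasing) auto
  also have "\<dots> = totient (p ^ e) ^ 2"
    unfolding f totient_prime_power_Suc[OF p(1)] by (simp add: power_mult_distrib power_mult mult.commute)
  finally have 1: "2 * p ^ e \<le> totient (p ^ e) ^ 2" by (simp add: f mult_ac)
  have "odd m" using assms(1) m(1) by auto
  then have 2: "m \<le> totient m ^ 2" by (rule le_totient_square_if_odd)
  have "coprime (p ^ e) m" using p(1) m(2) by (simp add: prime_imp_coprime)
  then have "totient n ^ 2 = totient (p ^ e) ^ 2 * totient m ^ 2"
    unfolding m(1) by (simp add: totient_mult_coprime power_mult_distrib)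
  then show ?thesis unfolding m(1) using mult_le_mono[OF 1 2] by simp
next
  case False
  have "n > 0" using assms(1) odd_pos by blast
  define e where "e = multiplicity 3 n"
  obtain m where m: "n = 3 ^ e * m" "\<not> 3 dvd m"
    using multiplicity_decompose'[of n 3] \<open>n > 0\<close> e_def by auto
  have "m = 1"
  proof (rule ccontr)
    assume "m \<noteq> 1"
    then obtain q where q: "prime q" "q dvd m" using prime_factor_nat by blast
    then have "q \<noteq> 3" using m(2) by auto
    then show False using False q m(1) by auto
  qed
  then have n: "n = 3 ^ e" using m(1) by simp
  then have "e \<noteq> 0" "e \<noteq> 1" using assms(2,3) by auto
  then obtain f where f: "e = Suc (Suc f)" by (metis One_nat_def not0_implies_Suc)
  have "totient n = 3 ^ Suc f * 2" unfolding n f by (subst totient_prime_power_Suc) simp_all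
  then have "totient n ^ 2 = 2 * (2 * (3 ^ f * (9 * 3 ^ f)))"
    by (simp add: power2_eq_square)
  moreover have "(3::nat) ^ f \<ge> 1" by simp
  then have "1 * (9 * 3 ^ f) \<le> (3::nat) ^ f * (9 * 3 ^ f)" by (intro mult_le_mono) auto
  ultimately show ?thesis unfolding n f by simp
qed

text \<open>Halving an even \<open>n = 2 * k\<close> leaves the totient unchanged for odd
  \<open>k\<close>, which costs the factor 2, and halves it for even \<open>k\<close>, which more
  than pays for the step.\<close>

lemma le_double_totient_square:
  fixes n :: nat
  assumes "n > 0"
  shows "n \<le> 2 * totient n ^ 2"
  using assms
proof (induction n rule: less_induct)
  case (less n)
  show ?case
  proof (cases "even n")
    case True
    then obtain k where k: "n = 2 * k" by (elim evenE)
    have "k \<le> 2 * totient k ^ 2" using less.prems k by (intro less.IH) auto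
    then show ?thesis unfolding k totient_double
      using le_totient_square_if_odd[of k] by (auto simp: power_mult_distrib)
  next
    case False
    then show ?thesis using le_totient_square_if_odd[of n] by simp
  qed
qed

section \<open>Counting irreducible divisors by degree\<close>

text \<open>Distinct monic irreducible polynomials are coprime, so their product still divides
  \<open>Q\<close>.\<close>

lemma sum_degree_irreducible_divisors_le:
  fixes Q :: "'a::field_gcd poly"
  assumes "Q \<noteq> 0" "finite A"
    and "\<And>P. P \<in> A \<Longrightarrow> lead_coeff P = 1 \<and> irreducible P \<and> P dvd Q"
  shows "(\<Sum>P\<in>A. degree P) \<le> degree Q"
proof -
  have pr: "prime P" if "P \<in> A" for P
    using assms(3)[OF that] by (auto simp: prime_def normalize_monic field_poly_irreducible_imp_prime)
  have "\<Prod>A dvd Q" using assms(2,3) pr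
  proof (induction A rule: finite_induct)
    case (insert P A)
    have "coprime P (\<Prod>A)"
    proof (rule prod_coprime_right)
      fix R assume "R \<in> A"
      then show "coprime P R" using insert.hyps(2) insert.prems(2) by (intro primes_coprime) auto
    qed
    then show ?case using insert by (simp add: divides_mult)
  qed simp
  then have "degree (\<Prod>A) \<le> degree Q" using assms(1) by (rule dvd_imp_degree_le)
  moreover have "degree (\<Prod>A) = (\<Sum>P\<in>A. degree P)"
    using assms(3) by (intro degree_prod_eq_sum_degree) auto
  ultimately show ?thesis by simp
qed

text \<open>The weights \<open>c\<close> and \<open>b\<close> allow the bound
  \<open>totient (2 * n) \<le> 2 * degree P\<close> to be used without division. Finiteness of
  \<open>A\<close> follows from the uniform bound on its finite subsets.\<close>

lemma card_irreducible_divisors_le: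
  fixes Q :: "'a::field_gcd poly"
  assumes "Q \<noteq> 0"
    and "\<And>P. P \<in> A \<Longrightarrow> lead_coeff P = 1 \<and> irreducible P \<and> P dvd Q"
    and c: "c > 0" "\<And>P. P \<in> A \<Longrightarrow> c \<le> b * degree P"
  shows "finite A \<and> c * card A \<le> b * degree Q"
proof -
  have bnd: "c * card B \<le> b * degree Q" if "finite B" "B \<subseteq> A" for B
  proof -
    have "c * card B = (\<Sum>P\<in>B. c)" by simp
    also have "\<dots> \<le> (\<Sum>P\<in>B. b * degree P)" using that c(2) by (intro sum_mono) auto
    also have "\<dots> \<le> b * degree Q"
      using sum_degree_irreducible_divisors_le[OF assms(1) that(1)] assms(2) that(2)
      by (auto simp flip: sum_distrib_left intro!: mult_left_mono)
    finally show ?thesis .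
  qed
  have "finite A"
  proof (rule finite_if_finite_subsets_card_bdd[THEN conjunct1])
    fix B assume "B \<subseteq> A" "finite B"
    then have "c * card B \<le> b * degree Q" using bnd by blast
    moreover have "1 * card B \<le> c * card B" using c(1) by (intro mult_le_mono) auto
    ultimately show "card B \<le> b * degree Q" by linarith
  qed
  then show ?thesis using bnd by auto
qed

section \<open>New parts of the Pell sequence and their factors\<close>

text \<open>The product over proper divisors of \<open>k\<close> is a factor of the nonzero
  \<open>pell_v D u v k\<close>, so it can be cancelled. Strong induction then gives the uniqueness
  that the definite description requires.\<close>

lemma pell_v_new_eq:
  fixes D u v :: "'a::idom poly"
  assumes w: "\<And>k. k \<ge> 1 \<Longrightarrow> pell_v D u v k = (\<Prod>m | m dvd k. w m)"
    and nz: "\<And>k. k \<ge> 1 \<Longrightarrow> pell_v D u v k \<noteq> 0" and "n \<ge> 1"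
  shows "pell_v_new D u v n = w n"
  unfolding pell_v_new_def
proof (rule the_equality)
  show "\<exists>w'. (\<forall>k\<ge>1. pell_v D u v k = (\<Prod>m | m dvd k. w' m)) \<and> w n = w' n"
    using w by blast
  fix p assume "\<exists>w'. (\<forall>k\<ge>1. pell_v D u v k = (\<Prod>m | m dvd k. w' m)) \<and> p = w' n"
  then obtain w' where w': "\<And>k. k \<ge> 1 \<Longrightarrow> pell_v D u v k = (\<Prod>m | m dvd k. w' m)" "p = w' n"
    by blast
  have "w' k = w k" if "k \<ge> 1" for k
    using that
  proof (induction k rule: less_induct)
    case (less k)
    let ?M = "{m. m dvd k} - {k}"
    have fin: "finite {m. m dvd k}" using less.prems by simp
    have split: "(\<Prod>m | m dvd k. f m) = f k * (\<Prod>m\<in>?M. f m)" for f :: "nat \<Rightarrow> 'a poly"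
      using fin by (intro prod.remove) auto
    have "(\<Prod>m\<in>?M. w' m) = (\<Prod>m\<in>?M. w m)"
    proof (rule prod.cong[OF refl])
      fix m assume m: "m \<in> ?M"
      then have "m \<le> k" using less.prems by (auto intro: dvd_imp_le)
      moreover have "m \<ge> 1" using m less.prems dvd_pos_nat[of k m] by auto
      ultimately show "w' m = w m" using m by (intro less.IH) auto
    qed
    then have "w' k * (\<Prod>m\<in>?M. w m) = w k * (\<Prod>m\<in>?M. w m)"
      using w[OF less.prems] w'(1)[OF less.prems] unfolding split[of w] split[of w'] by simp
    moreover have "(\<Prod>m\<in>?M. w m) \<noteq> 0"
      using nz[OF less.prems] unfolding w[OF less.prems] split[of w] by auto
    ultimately show ?case by simp
  qed
  then show "p = w n" using w'(2) assms(3) by simp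
qed

text \<open>A complex root of \<open>P\<close> is sent by \<open>u\<close> to a root of
  \<open>cos_new n\<close>, that is, to some \<open>cos (pi * k / n)\<close> with \<open>k\<close>
  coprime to \<open>n\<close>.\<close>

lemma totient_le_degree_if_dvd_comp_cos_new:
  fixes P u \<psi> :: "rat poly"
  assumes \<psi>: "map_poly of_rat \<psi> = cos_new n" and n: "n \<ge> 2"
    and P: "degree P > 0" "P dvd pcompose \<psi> u"
  shows "totient (2 * n) \<le> 2 * degree P"
proof -
  have "\<not> constant (poly (map_poly of_rat P :: complex poly))"
    using P(1) by (simp add: constant_degree)
  then obtain \<alpha> :: complex where \<alpha>: "poly (map_poly of_rat P) \<alpha> = 0"
    using fundamental_theorem_of_algebra by blast
  have "poly (map_poly of_rat (pcompose \<psi> u)) \<alpha> = 0"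
    using \<alpha> of_rat_poly_hom.hom_dvd[OF P(2)] by (meson dvd_trans poly_eq_0_iff_dvd)
  then have "poly (cos_new n) (poly (map_poly of_rat u) \<alpha>) = 0"
    by (simp add: of_rat_hom.map_poly_pcompose poly_pcompose \<psi>)
  then obtain k where k: "k \<in> totatives n"
      "poly (map_poly of_rat u) \<alpha> = complex_of_real (cos (pi * k / n))"
    by (auto simp: cos_new_def cos_linear_def poly_prod)
  show ?thesis
    using P(1) n k(1) \<alpha> k(2)
    by (intro totient_le_degree_if_root_comp_cos[of P n k \<alpha> u]) (auto simp: in_totatives_iff)
qed

lemma card_union3_le:
  assumes "S \<subseteq> A \<union> (\<Union>n\<in>E. T n) \<union> (\<Union>n\<in>F. T n)"
    and "finite A" "finite E" "finite F" "\<And>n. n \<in> E \<union> F \<Longrightarrow> finite (T n)"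
    and "card A \<le> a" "\<And>n. n \<in> E \<Longrightarrow> card (T n) \<le> b" "\<And>n. n \<in> F \<Longrightarrow> card (T n) \<le> c"
  shows "finite S \<and> card S \<le> a + card E * b + card F * c"
proof -
  have fin: "finite (A \<union> (\<Union>n\<in>E. T n) \<union> (\<Union>n\<in>F. T n))" using assms by auto
  have "card (\<Union>n\<in>E. T n) \<le> (\<Sum>n\<in>E. card (T n))" by (rule card_UN_le[OF assms(3)])
  also have "\<dots> \<le> card E * b" using sum_bounded_above[of E "\<lambda>n. card (T n)" b] assms(7) by simp
  finally have 1: "card (\<Union>n\<in>E. T n) \<le> card E * b" .
  have "card (\<Union>n\<in>F. T n) \<le> (\<Sum>n\<in>F. card (T n))" by (rule card_UN_le[OF assms(4)])
  also have "\<dots> \<le> card F * c" using sum_bounded_above[of F "\<lambda>n. card (T n)" c] assms(8) by simp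
  finally have 2: "card (\<Union>n\<in>F. T n) \<le> card F * c" .
  have "card S \<le> card (A \<union> (\<Union>n\<in>E. T n) \<union> (\<Union>n\<in>F. T n))" by (rule card_mono[OF fin assms(1)])
  also have "\<dots> \<le> card A + card (\<Union>n\<in>E. T n) + card (\<Union>n\<in>F. T n)"
    by (meson add_right_mono card_Un_le order_trans)
  finally show ?thesis using 1 2 assms(6) finite_subset[OF assms(1) fin] by linarith
qed

theorem proposition3p3:
  fixes D u v :: "rat poly" and N :: nat
  assumes "degree D > 0"
    and "pell_fundamental (map_poly (of_rat :: rat \<Rightarrow> complex) D) (map_poly of_rat u) (map_poly of_rat v)"
    and "N > 0"
  shows "finite (pell_new_factors D u v N) \<and> card (pell_new_factors D u v N) \<le> 4 * N ^ 2 * degree u"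
proof -
  have sol: "pell_solution D u v" and v0: "v \<noteq> 0"
  proof -
    have "(map_poly of_rat (u\<^sup>2 - D * v\<^sup>2) :: complex poly) = map_poly of_rat 1"
      using assms(2) unfolding pell_fundamental_def pell_solution_def
      by (simp add: of_rat_poly_hom.hom_minus of_rat_poly_hom.hom_mult of_rat_poly_hom.hom_power)
    then have "u\<^sup>2 - D * v\<^sup>2 = 1" by (rule of_rat_poly_hom.injectivity)
    then show "pell_solution D u v" by (simp add: pell_solution_def)
    show "v \<noteq> 0" using assms(2) by (auto simp: pell_fundamental_def)
  qed
  have "D \<noteq> 0" using assms(1) by auto
  then have Dv: "degree (D * v\<^sup>2) = degree D + 2 * degree v"
    using v0 by (simp add: degree_mult_eq degree_power_eq)
  have "degree (u\<^sup>2) = degree (D * v\<^sup>2)"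
  proof -
    have "degree (D * v\<^sup>2) > 0" using Dv assms(1) by simp
    moreover have "u\<^sup>2 = D * v\<^sup>2 + 1" using sol by (simp add: pell_solution_def algebra_simps)
    ultimately show ?thesis by (simp add: degree_add_eq_left)
  qed
  then have degu: "2 * degree u = degree D + 2 * degree v"
    using Dv assms(1) by (cases "u = 0") (auto simp: degree_power_eq)
  \<comment> \<open>The first fact keeps compositions with \<open>u\<close> nonzero; the second
    bounds the number of factors of \<open>v\<close>.\<close>
  then have du: "degree u > 0" "degree v \<le> degree u" using assms(1) by auto
  have "\<forall>n. \<exists>p :: rat poly. n > 0 \<longrightarrow> map_poly of_rat p = cos_new n" using cos_new_rat by blast
  then obtain \<psi> :: "nat \<Rightarrow> rat poly" where \<psi>: "\<And>n. n > 0 \<Longrightarrow> map_poly of_rat (\<psi> n) = cos_new n"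
    by metis
  have \<psi>0: "\<psi> n \<noteq> 0" if "n > 0" for n
    using \<psi>[OF that] cos_new_nonzero[of n] by auto
  have \<psi>1: "\<psi> 1 = 1"
    using \<psi>[of 1] by (intro of_rat_poly_hom.injectivity[where ?'a = complex]) (simp add: cos_new_1)
  have prod_\<psi>: "(\<Prod>m | m dvd n. \<psi> m) = cheb n" if "n > 0" for n
  proof (rule of_rat_poly_hom.injectivity[where ?'a = complex])
    have "(\<Prod>m | m dvd n. map_poly of_rat (\<psi> m)) = (\<Prod>m | m dvd n. cos_new m)"
      using that by (intro prod.cong refl \<psi>) (auto intro: dvd_pos_nat)
    then show "map_poly of_rat (\<Prod>m | m dvd n. \<psi> m) = (map_poly of_rat (cheb n) :: complex poly)"
      by (simp add: of_rat_poly_hom.hom_prod map_poly_of_rat_cheb prod_cos_new_eq_cheb[OF that])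
  qed
  \<comment> \<open>The factor \<open>v\<close> occurs once in every
    \<open>v * pcompose (cheb n) u\<close>, so it is assigned to the index 1, which divides every
    \<open>n\<close>; there \<open>\<psi> 1\<close> is 1.\<close>
  define w where "w = (\<lambda>n. (if n = 1 then v else 1) * pcompose (\<psi> n) u)"
  have w_prod: "pell_v D u v k = (\<Prod>m | m dvd k. w m)" if "k \<ge> 1" for k
  proof -
    have "(\<Prod>m | m dvd k. w m) =
        (\<Prod>m | m dvd k. if m = 1 then v else 1) * pcompose (\<Prod>m | m dvd k. \<psi> m) u"
      by (simp add: w_def prod.distrib pcompose_prod)
    also have "(\<Prod>m | m dvd k. if m = 1 then v else 1) = v" using that by simp
    finally show ?thesis using that by (simp add: prod_\<psi> pell_v_eq_cheb[OF sol])
  qed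
  have w0: "w n \<noteq> 0" if "n \<ge> 1" for n
    using that \<psi>0[of n] v0 du(1) pcompose_eq_0[of "\<psi> n" u] by (auto simp: w_def)
  have "pell_v D u v k \<noteq> 0" if "k \<ge> 1" for k
    unfolding w_prod[OF that] using that w0 by (auto dest: dvd_pos_nat simp: Suc_le_eq)
  then have new: "pell_v_new D u v n = w n" if "n \<ge> 1" for n
    by (intro pell_v_new_eq w_prod that)
  have w1: "w 1 = v" unfolding w_def \<psi>1 pcompose_1 by simp
  have w2: "w n = pcompose (\<psi> n) u" if "n \<ge> 2" for n using that by (simp add: w_def)

  define T where "T = (\<lambda>n. {P. lead_coeff P = 1 \<and> irreducible P \<and> degree P \<le> N \<and> P dvd w n})"
  have irr_deg: "degree P > 0" if "irreducible P" for P :: "rat poly"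
    using that by (metis gr0I irreducible_def is_unit_iff_degree)
  have "finite (T 1) \<and> 1 * card (T 1) \<le> 1 * degree (w 1)"
    using w0[of 1] irr_deg
    by (intro card_irreducible_divisors_le) (auto simp: T_def Suc_le_eq)
  then have T1: "finite (T 1)" "card (T 1) \<le> degree u"
    using du(2) unfolding w1 by simp_all
  have degP: "totient (2 * n) \<le> 2 * degree P" if "n \<ge> 2" "P \<in> T n" for n P
    using that irr_deg \<psi>[of n] w2[OF that(1)]
    by (intro totient_le_degree_if_dvd_comp_cos_new[of "\<psi> n" n P u]) (auto simp: T_def)
  have Tn: "finite (T n) \<and> totient (2 * n) * card (T n) \<le> 2 * (totient n * degree u)" if "n \<ge> 2" for n
  proof -
    have "degree (\<psi> n) = totient n"
      using degree_cos_new[OF that] \<psi>[of n] that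
      by (metis of_rat_hom.degree_map_poly_hom less_le_trans pos2)
    then have "degree (w n) = totient n * degree u" by (simp add: w2[OF that] degree_pcompose)
    then show ?thesis
      using card_irreducible_divisors_le[of "w n" "T n" "totient (2 * n)" 2] w0[of n] degP[OF that] that
      by (auto simp: T_def)
  qed
  \<comment> \<open>For even \<open>n\<close>, \<open>totient (2 * n)\<close> is
    \<open>2 * totient n\<close>, which cancels the 2; for odd \<open>n\<close> it is only
    \<open>totient n\<close>, so the bound doubles.\<close>
  have T_even: "card (T n) \<le> degree u" if "n \<ge> 2" "even n" for n
    using Tn[OF that(1)] that by (simp add: totient_double)
  have T_odd: "card (T n) \<le> 2 * degree u" if "n \<ge> 2" "odd n" for n
  proof -
    have "totient (2 * n) = totient n" using that(2) by (simp add: totient_double)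
    then have "totient n * card (T n) \<le> totient n * (2 * degree u)"
      using Tn[OF that(1)] by (simp only: mult.left_commute[of 2])
    then show ?thesis using that by simp
  qed
  \<comment> \<open>These are the even indices up to \<open>2 * N^2\<close> and the odd indices from
    5 below \<open>2 * N^2\<close>. The index 3 is listed separately because the odd totient bound
    excludes it.\<close>
  define E where "E = (\<lambda>i. 2 * i) ` {1..N\<^sup>2}"
  define F where "F = insert 3 ((\<lambda>i. 2 * i + 1) ` {2..<N\<^sup>2})"
  have cardE: "card E = N\<^sup>2" unfolding E_def by (subst card_image) (auto simp: inj_on_def)
  have "card F \<le> Suc (card ((\<lambda>i. 2 * i + 1) ` {2..<N\<^sup>2}))"
    unfolding F_def by (rule card_insert_le_m1) simp_all
  \<comment> \<open>For \<open>N = 1\<close> the truncated subtraction gives 0, so the bound is 1,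
    in agreement with \<open>F = {3}\<close>.\<close>
  also have "\<dots> \<le> Suc (N\<^sup>2 - 2)" using card_image_le[of "{2..<N\<^sup>2}"] by simp
  also have "\<dots> \<le> N\<^sup>2" using assms(3) by (cases "N\<^sup>2") auto
  finally have cardF: "card F \<le> N\<^sup>2" .
  have sub: "pell_new_factors D u v N \<subseteq> T 1 \<union> (\<Union>n\<in>E. T n) \<union> (\<Union>n\<in>F. T n)"
  proof
    fix P assume "P \<in> pell_new_factors D u v N"
    then obtain n where n: "n \<ge> 1" "P \<in> T n" "degree P \<le> N"
      by (auto simp: pell_new_factors_def T_def new)
    show "P \<in> T 1 \<union> (\<Union>n\<in>E. T n) \<union> (\<Union>n\<in>F. T n)"
    proof (cases "n = 1")
      case False
      then have "n \<ge> 2" using n(1) by simp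
      then have tot: "totient (2 * n) \<le> 2 * N" using degP[OF _ n(2)] n(3) by fastforce
      have "n \<in> E \<union> F"
      proof (cases "even n")
        case True
        then have "totient n \<le> N" using tot by (simp add: totient_double)
        then have "totient n ^ 2 \<le> N\<^sup>2" by (simp add: power_mono)
        then have "n \<le> 2 * N\<^sup>2" using le_double_totient_square[of n] n(1) by linarith
        then show ?thesis using True n(1) by (auto simp: E_def elim!: evenE)
      next
        case False
        show ?thesis
        proof (cases "n = 3")
          case neq3: False
          \<comment> \<open>This is weaker by a factor 2 than in the even case; the stronger bound
            \<open>2 * n \<le> totient n ^ 2\<close> still gives
            \<open>n \<le> 2 * N^2\<close>.\<close>
          have "totient n \<le> 2 * N" using False tot by (simp add: totient_double)
          then have "totient n ^ 2 \<le> (2 * N)\<^sup>2" by (rule power_mono) simp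
          then have "2 * n \<le> 4 * N\<^sup>2"
            using double_le_totient_square_if_odd[OF False \<open>n \<noteq> 1\<close> neq3] by (simp add: power_mult_distrib)
          moreover obtain i where i: "n = 2 * i + 1" using False by (elim oddE)
          ultimately have "i < N\<^sup>2" by linarith
          moreover have "i \<noteq> 0" "i \<noteq> 1" using i neq3 \<open>n \<noteq> 1\<close> by auto
          then have "i \<ge> 2" by linarith
          ultimately have "i \<in> {2..<N\<^sup>2}" by simp
          then show ?thesis unfolding F_def i by blast
        qed (simp add: F_def)
      qed
      then show ?thesis using n(2) by blast
    qed (use n in simp)
  qed
  have E2: "n \<ge> 2" "even n" if "n \<in> E" for n using that by (auto simp: E_def)
  have F2: "n \<ge> 2" "odd n" if "n \<in> F" for n using that by (auto simp: F_def)
  have "finite (pell_new_factors D u v N) \<and>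
      card (pell_new_factors D u v N) \<le> degree u + card E * degree u + card F * (2 * degree u)"
  proof (rule card_union3_le[OF sub T1(1) _ _ _ T1(2)])
    show "finite E" "finite F" by (simp_all add: E_def F_def)
    show "finite (T n)" if "n \<in> E \<union> F" for n using that Tn[of n] E2(1)[of n] F2(1)[of n] by auto
    show "card (T n) \<le> degree u" if "n \<in> E" for n by (rule T_even[OF E2[OF that]])
    show "card (T n) \<le> 2 * degree u" if "n \<in> F" for n by (rule T_odd[OF F2[OF that]])
  qed
  moreover have "degree u + card E * degree u + card F * (2 * degree u) \<le> 4 * N\<^sup>2 * degree u"
  proof -
    have "degree u + card E * degree u + card F * (2 * degree u) = (1 + card E + 2 * card F) * degree u"
      by (simp add: algebra_simps)
    also have "\<dots> \<le> (4 * N\<^sup>2) * degree u"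
    proof (rule mult_right_mono)
      \<comment> \<open>Since \<open>N^2\<close> is at least 1, it absorbs the contribution of the
        index 1.\<close>
      have "N\<^sup>2 > 0" using assms(3) by simp
      then show "1 + card E + 2 * card F \<le> 4 * N\<^sup>2" using cardE cardF by linarith
    qed simp
    finally show ?thesis .
  qed
  ultimately show ?thesis by linarith
qed

end
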